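(* Let $n\ge1$. If $f:\mathbb{R}^n\to\mathbb{R}^n$ is a $C^1$ map with nilpotent fixed points and the range $f(\mathbb{R}^n)$ of $f$ is bounded, then $f$ has a unique fixed point.
   Context: "$f$ has nilpotent fixed points" means that the Jacobian matrix $J(f)(p)$ is nilpotent at each fixed point $p$ of $f$. *)

theory Defs
  imports "HOL-Analysis.Analysis"
begin

definition jacobian :: "(real ^ 'n \<Rightarrow> real ^ 'm) \<Rightarrow> real ^ 'n \<Rightarrow> real ^ 'n ^ 'm"
  where "jacobian f p = matrix (frechet_derivative f (at p))"

text \<open>Continuity of the Jacobian is continuity of all its entries, that is, of all partial
  derivatives of \<open>f\<close>. Differentiability is required separately because
  \<^const>\<open>frechet_derivative\<close> is unspecified where \<open>f\<close> is not differentiable.\<close>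

definition C1_map :: "(real ^ 'n \<Rightarrow> real ^ 'm) \<Rightarrow> bool"
  where "C1_map f \<longleftrightarrow> (\<forall>x. f differentiable (at x)) \<and> continuous_on UNIV (jacobian f)"

text \<open>The library multiplication on \<^typ>\<open>real ^ 'n ^ 'n\<close>, and hence \<open>^\<close>, is componentwise,
  so the powers of a matrix are iterated with \<open>**\<close> here.\<close>

definition matrix_power :: "real ^ 'n ^ 'n \<Rightarrow> nat \<Rightarrow> real ^ 'n ^ 'n"
  where "matrix_power A k = (((**) A) ^^ k) (mat 1)"

definition nilpotent_matrix :: "real ^ 'n ^ 'n \<Rightarrow> bool"
  where "nilpotent_matrix A \<longleftrightarrow> (\<exists>k. matrix_power A k = 0)"

definition nilpotent_fixed_points :: "(real ^ 'n \<Rightarrow> real ^ 'n) \<Rightarrow> bool"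
  where "nilpotent_fixed_points f \<longleftrightarrow> (\<forall>p. f p = p \<longrightarrow> nilpotent_matrix (jacobian f p))"

end

theory Submission
  imports Defs
begin

text \<open>
  Existence is Brouwer's theorem: \<open>f\<close> maps a large closed ball into itself. Uniqueness is a degree
  argument. Put \<open>g x = x - f x\<close>. At a zero \<open>p\<close> of \<open>g\<close> the derivative of \<open>f\<close> is nilpotent, so
  \<open>v \<mapsto> v - s *\<^sub>R D p v\<close> is injective for every \<open>s \<in> {0..1}\<close>; its determinant is \<open>1\<close> at \<open>s = 0\<close> and
  cannot change sign, so it is positive at \<open>s = 1\<close>. Thus every zero of \<open>g\<close> counts with sign \<open>+1\<close>, while
  \<open>g\<close>, being a bounded perturbation of the identity, has degree \<open>1\<close>: there is only one zero.

  What is needed of degree theory is proved directly, for maps that are merely \<open>C\<^sup>1\<close>. A cutoff makes \<open>f\<close>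
  vanish outside a ball \<open>B\<close> without touching its fixed points or the derivatives there. Let
  \<open>g\<^sub>t x = x - t *\<^sub>R f x\<close>. For a polynomial \<open>p\<close> the integral of \<open>p (g\<^sub>t x) * det (D g\<^sub>t x)\<close> over \<open>B\<close> is a
  polynomial in \<open>t\<close>. For small \<open>t > 0\<close> the map \<open>g\<^sub>t\<close> is a bijection of \<open>B\<close> with positive Jacobian
  determinant, so by change of variables this polynomial is constantly the integral of \<open>p\<close> over
  \<open>B\<close> near \<open>0\<close>, hence also at \<open>t = 1\<close>. By the Stone--Weierstrass theorem the same formula at
  \<open>t = 1\<close> holds for every continuous \<open>\<phi>\<close> in place of \<open>p\<close> (\<open>integral_of_continuous\<close> below).

  Now let \<open>\<phi>\<close> be a bump concentrated near \<open>0\<close>. The inverse function theorem gives each zero of \<open>g\<close> a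
  neighbourhood that contributes a full integral of \<open>\<phi>\<close> to the left-hand side, and nothing contributes
  negatively; two zeros would make that side at least twice the integral of \<open>\<phi>\<close>
  (\<open>fixed_point_unique\<close>).

  The change of variables theorem speaks about \<open>real^'m\<close> with a well-ordered index type, so the
  argument is carried out there and then transported along a linear isomorphism to an arbitrary
  Euclidean space, where the condition on fixed points is stated without coordinates.
\<close>

section \<open>Integrals over compact sets and the sign of a determinant\<close>

lemma absolutely_integrable_on_compact:
  fixes f :: "'a::euclidean_space \<Rightarrow> real"
  assumes "compact S" "continuous_on S f"
  shows "f absolutely_integrable_on S"
proof -
  have "integrable lborel (\<lambda>x. indicator S x *\<^sub>R f x)"
    using borel_integrable_compact[OF assms] by (simp add: indicator_scaleR_eq_if)
  then show ?thesis
    unfolding set_integrable_def using integrable_completion borel_measurable_integrable by blast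
qed

lemma integrable_on_compact:
  fixes f :: "'a::euclidean_space \<Rightarrow> real"
  assumes "compact S" "continuous_on S f"
  shows "f integrable_on S"
  using absolutely_integrable_on_compact[OF assms] absolutely_integrable_on_def by blast

lemma continuous_on_det_matrix:
  fixes D :: "'a::topological_space \<Rightarrow> real^'n \<Rightarrow> real^'n"
  assumes "\<And>v. continuous_on S (\<lambda>x. D x v)"
  shows "continuous_on S (\<lambda>x. det (matrix (D x)))"
  unfolding det_def matrix_def
  using assms by (auto intro!: continuous_intros)

text \<open>Along the segment from the identity to \<open>id - A\<close> the determinant starts at \<open>1\<close> and never
  vanishes. Both uses of positivity rest on this: for nilpotent derivatives, and for derivatives of
  norm less than \<open>1\<close>.\<close>

lemma det_id_minus_pos:
  fixes A :: "real^'n \<Rightarrow> real^'n"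
  assumes A: "linear A"
    and inj: "\<And>s v. \<lbrakk>0 \<le> s; s \<le> 1; v = s *\<^sub>R A v\<rbrakk> \<Longrightarrow> v = 0"
  shows "0 < det (matrix (\<lambda>v. v - A v))"
proof (rule ccontr)
  define d where "d s = det (matrix (\<lambda>v. v - s *\<^sub>R A v))" for s :: real
  have "continuous_on {0..1} d"
    unfolding d_def by (intro continuous_on_det_matrix continuous_intros)
  moreover have "d 0 = 1"
    using matrix_id by (simp add: d_def matrix_id id_def[symmetric])
  moreover assume "\<not> 0 < det (matrix (\<lambda>v. v - A v))"
  then have "d 1 \<le> 0" by (simp add: d_def)
  ultimately obtain s where s: "0 \<le> s" "s \<le> 1" "d s = 0"
    using IVT2'[of d 1 0 0] by auto
  have lin: "linear (\<lambda>v. v - s *\<^sub>R A v)"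
    using A by (intro linear_compose_sub linear_compose_scale_right linear_ident)
  then have "inj (\<lambda>v. v - s *\<^sub>R A v)"
    using inj[of s] s by (auto simp: linear_injective_0)
  then show False
    using det_nz_iff_inj[OF lin] s by (simp add: d_def)
qed

text \<open>The scalar case of the change of variables theorem, read off from its version for integrands
  with values in \<^typ>\<open>real^1\<close>.\<close>

lemma integral_change_of_variables_compact:
  fixes g :: "real^'m::{finite,wellorder} \<Rightarrow> real^'m::_" and \<phi> :: "real^'m::_ \<Rightarrow> real"
  assumes S: "compact S"
    and g: "\<And>x. x \<in> S \<Longrightarrow> (g has_derivative g' x) (at x within S)" "inj_on g S"
    and \<phi>: "continuous_on (g ` S) \<phi>"
  shows "integral S (\<lambda>x. \<bar>det (matrix (g' x))\<bar> * \<phi> (g x)) = integral (g ` S) \<phi>"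
proof -
  have c: "compact (g ` S)"
    using S g(1) by (intro compact_continuous_image has_derivative_continuous_on)
  have i: "\<phi> absolutely_integrable_on (g ` S)"
    by (rule absolutely_integrable_on_compact[OF c \<phi>])
  have "integral (g ` S) (\<lambda>x. vec (\<phi> x) :: real^1) = vec (integral (g ` S) \<phi>)"
    by (simp add: integral_on_1_eq o_def)
  moreover have "(\<lambda>x. vec (\<phi> x) :: real^1) absolutely_integrable_on (g ` S)"
    using i by (simp add: absolutely_integrable_on_1_iff)
  ultimately have "integral S (\<lambda>x. \<bar>det (matrix (g' x))\<bar> *\<^sub>R vec (\<phi> (g x)) :: real^1) =
      vec (integral (g ` S) \<phi>)"
    using has_absolute_integral_change_of_variables_compact[OF S g, where f = "\<lambda>x. vec (\<phi> x) :: real^1"]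
    by blast
  then show ?thesis
    by (simp add: integral_on_1_eq o_def vec_eq_iff)
qed

section \<open>Integrands that depend polynomially on a parameter\<close>

text \<open>A polynomial in \<open>t\<close> whose coefficients are continuous in \<open>x\<close>. The bound on the degree is uniform
  in \<open>x\<close>, so that integrating in \<open>x\<close> coefficient by coefficient again gives a polynomial in \<open>t\<close>.\<close>

definition polynomial_in_parameter :: "'a::topological_space set \<Rightarrow> (real \<Rightarrow> 'a \<Rightarrow> real) \<Rightarrow> bool" where
  "polynomial_in_parameter S F \<longleftrightarrow> (\<exists>q N. (\<forall>i. continuous_on S (\<lambda>x. coeff (q x) i)) \<and>
     (\<forall>x. degree (q x) \<le> N) \<and> (\<forall>t. \<forall>x\<in>S. F t x = poly (q x) t))"

lemma polynomial_in_parameterI: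
  assumes "\<And>i. continuous_on S (\<lambda>x. coeff (q x) i)" "\<And>x. degree (q x) \<le> N"
    "\<And>t x. x \<in> S \<Longrightarrow> F t x = poly (q x) t"
  shows "polynomial_in_parameter S F"
  unfolding polynomial_in_parameter_def using assms by blast

lemma polynomial_in_parameter_affine:
  assumes "continuous_on S a" "continuous_on S b"
  shows "polynomial_in_parameter S (\<lambda>t x. a x + t * b x)"
proof (rule polynomial_in_parameterI[of _ "\<lambda>x. [:a x, b x:]" 1])
  show "continuous_on S (\<lambda>x. coeff [:a x, b x:] i)" for i
    using assms by (cases i; cases "i - 1") (auto simp: coeff_pCons)
qed auto

lemma polynomial_in_parameter_const: "polynomial_in_parameter S (\<lambda>t x. c)"
  using polynomial_in_parameter_affine[of S "\<lambda>_. c" "\<lambda>_. 0"] by simp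

lemma polynomial_in_parameter_add:
  assumes "polynomial_in_parameter S F" "polynomial_in_parameter S G"
  shows "polynomial_in_parameter S (\<lambda>t x. F t x + G t x)"
proof -
  obtain p M q N where "\<And>i. continuous_on S (\<lambda>x. coeff (p x) i)" "\<And>x. degree (p x) \<le> M"
      "\<And>t x. x \<in> S \<Longrightarrow> F t x = poly (p x) t"
      "\<And>i. continuous_on S (\<lambda>x. coeff (q x) i)" "\<And>x. degree (q x) \<le> N"
      "\<And>t x. x \<in> S \<Longrightarrow> G t x = poly (q x) t"
    using assms unfolding polynomial_in_parameter_def by metis
  then show ?thesis
    by (intro polynomial_in_parameterI[of _ "\<lambda>x. p x + q x" "M + N"])
       (auto intro!: continuous_intros degree_add_le intro: trans_le_add1 trans_le_add2)
qed

lemma polynomial_in_parameter_mult: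
  assumes "polynomial_in_parameter S F" "polynomial_in_parameter S G"
  shows "polynomial_in_parameter S (\<lambda>t x. F t x * G t x)"
proof -
  obtain p M q N where "\<And>i. continuous_on S (\<lambda>x. coeff (p x) i)" "\<And>x. degree (p x) \<le> M"
      "\<And>t x. x \<in> S \<Longrightarrow> F t x = poly (p x) t"
      "\<And>i. continuous_on S (\<lambda>x. coeff (q x) i)" "\<And>x. degree (q x) \<le> N"
      "\<And>t x. x \<in> S \<Longrightarrow> G t x = poly (q x) t"
    using assms unfolding polynomial_in_parameter_def by metis
  then show ?thesis
    by (intro polynomial_in_parameterI[of _ "\<lambda>x. p x * q x" "M + N"])
       (auto intro!: continuous_intros order_trans[OF degree_mult_le] add_mono simp: coeff_mult)
qed

lemma polynomial_in_parameter_sum: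
  "(\<And>i. i \<in> I \<Longrightarrow> polynomial_in_parameter S (F i)) \<Longrightarrow>
    polynomial_in_parameter S (\<lambda>t x. \<Sum>i\<in>I. F i t x)"
  by (induction I rule: infinite_finite_induct)
     (auto intro: polynomial_in_parameter_const polynomial_in_parameter_add)

lemma polynomial_in_parameter_prod:
  "(\<And>i. i \<in> I \<Longrightarrow> polynomial_in_parameter S (F i)) \<Longrightarrow>
    polynomial_in_parameter S (\<lambda>t x. \<Prod>i\<in>I. F i t x)"
  by (induction I rule: infinite_finite_induct)
     (auto intro: polynomial_in_parameter_const polynomial_in_parameter_mult)

lemma polynomial_in_parameter_det:
  fixes A :: "real \<Rightarrow> 'a::topological_space \<Rightarrow> real^'n^'n"
  assumes "\<And>i j. polynomial_in_parameter S (\<lambda>t x. A t x $ i $ j)"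
  shows "polynomial_in_parameter S (\<lambda>t x. det (A t x))"
  unfolding det_def
  by (intro polynomial_in_parameter_sum polynomial_in_parameter_mult polynomial_in_parameter_const
      polynomial_in_parameter_prod assms)

lemma polynomial_in_parameter_real_polynomial_function:
  fixes f :: "'a::real_normed_vector \<Rightarrow> 'a"
  assumes "real_polynomial_function p" "continuous_on S f"
  shows "polynomial_in_parameter S (\<lambda>t x. p (x - t *\<^sub>R f x))"
  using assms(1)
proof induction
  case (linear l)
  then interpret bounded_linear l .
  have "polynomial_in_parameter S (\<lambda>t x. l x + t * (- l (f x)))"
    using assms(2) by (intro polynomial_in_parameter_affine continuous_intros continuous_on) auto
  then show ?case by (simp add: diff scaleR)
qed (auto intro: polynomial_in_parameter_const polynomial_in_parameter_add polynomial_in_parameter_mult)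

lemma polynomial_in_parameter_integral:
  fixes F :: "real \<Rightarrow> 'a::euclidean_space \<Rightarrow> real"
  assumes "compact S" "polynomial_in_parameter S F"
  obtains Q where "\<And>t. integral S (F t) = poly Q t"
proof -
  obtain q N where q: "\<And>i. continuous_on S (\<lambda>x. coeff (q x) i)" "\<And>x. degree (q x) \<le> N"
      "\<And>t x. x \<in> S \<Longrightarrow> F t x = poly (q x) t"
    using assms(2) unfolding polynomial_in_parameter_def by metis
  have "integral S (F t) = poly (\<Sum>i\<le>N. monom (integral S (\<lambda>x. coeff (q x) i)) i) t" for t
  proof -
    have "integral S (F t) = integral S (\<lambda>x. \<Sum>i\<le>N. coeff (q x) i * t ^ i)"
    proof (rule integral_cong)
      fix x assume "x \<in> S"
      have "(\<Sum>i\<le>degree (q x). coeff (q x) i * t ^ i) = (\<Sum>i\<le>N. coeff (q x) i * t ^ i)"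
        using q(2) by (intro sum.mono_neutral_left) (auto simp: coeff_eq_0)
      then show "F t x = (\<Sum>i\<le>N. coeff (q x) i * t ^ i)"
        using \<open>x \<in> S\<close> by (simp add: q(3) poly_altdef)
    qed
    also have "\<dots> = (\<Sum>i\<le>N. integral S (\<lambda>x. coeff (q x) i * t ^ i))"
      using assms(1) by (intro integral_sum integrable_on_compact continuous_intros q) auto
    finally show ?thesis by (simp add: poly_sum poly_monom)
  qed
  then show thesis by (rule that)
qed

text \<open>This replaces homotopy invariance of the degree: a polynomial that is constant on an interval is
  constant.\<close>

lemma poly_eq_if_constant_near_0:
  fixes Q :: "real poly"
  assumes "0 < e" "\<And>t. \<lbrakk>0 < t; t < e\<rbrakk> \<Longrightarrow> poly Q t = c"
  shows "poly Q t = c"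
proof -
  have "infinite {t. poly (Q - [:c:]) t = 0}"
    using infinite_Ioo[OF assms(1)] by (rule infinite_super[rotated]) (use assms(2) in auto)
  then have "Q - [:c:] = 0"
    using poly_roots_finite by blast
  then show ?thesis by simp
qed

section \<open>The degree formula for compactly supported perturbations of the identity\<close>

text \<open>Continuity of the derivative is required vector by vector, which in finite dimension is the same
  as continuity in norm and is easier to transport between spaces. Vanishing already on the sphere
  of radius \<open>R\<close> keeps all fixed points in the open ball.\<close>

locale compactly_supported_C1 =
  fixes f :: "real^'m::{finite,wellorder} \<Rightarrow> real^'m::_" and D :: "real^'m::_ \<Rightarrow> real^'m::_ \<Rightarrow> real^'m::_"
    and R :: real
  assumes R_pos: "0 < R"
    and has_derivative_f: "\<And>x. (f has_derivative D x) (at x)"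
    and continuous_D: "\<And>v. continuous_on UNIV (\<lambda>x. D x v)"
    and vanishes: "\<And>x. R \<le> norm x \<Longrightarrow> f x = 0"
begin

lemma linear_D: "linear (D x)"
  using has_derivative_f by (rule has_derivative_linear)

lemma continuous_f: "continuous_on S f"
  by (rule has_derivative_continuous_on[OF has_derivative_at_withinI[OF has_derivative_f]])

lemma continuous_jacobian_determinant:
  "continuous_on S (\<lambda>x. det (matrix (\<lambda>v. v - t *\<^sub>R D x v)))"
  by (intro continuous_on_det_matrix continuous_intros continuous_on_subset[OF continuous_D]) auto

lemma has_derivative_id_minus:
  "((\<lambda>x. x - t *\<^sub>R f x) has_derivative (\<lambda>v. v - t *\<^sub>R D x v)) (at x within S)"
  by (auto intro!: derivative_eq_intros has_derivative_at_withinI[OF has_derivative_f])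

lemma bounded_derivative:
  obtains L where "0 < L" "\<And>x. onorm (D x) \<le> L"
proof -
  define N where "N x = (\<Sum>b\<in>Basis. norm (D x b))" for x
  have "compact (N ` cball 0 R)"
    unfolding N_def
    by (intro compact_continuous_image continuous_intros continuous_on_subset[OF continuous_D]) auto
  then obtain L where L: "0 < L" "\<And>x. x \<in> cball 0 R \<Longrightarrow> norm (N x) \<le> L"
    by (metis bounded_pos compact_imp_bounded imageI)
  have "onorm (D x) \<le> L" for x
  proof (cases "x \<in> cball 0 R")
    case True
    have "onorm (D x) \<le> N x"
      unfolding N_def using has_derivative_f by (intro onorm_componentwise has_derivative_bounded_linear)
    then show ?thesis using L(2)[OF True] by simp
  next
    case False
    have "((\<lambda>x. 0) has_derivative D x) (at x)"
      by (rule has_derivative_transform_within_open[where s = "- cball 0 R", OF has_derivative_f])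
         (use False in \<open>auto intro: vanishes\<close>)
    then have "D x = (\<lambda>v. 0)"
      using has_derivative_unique has_derivative_const by blast
    then show ?thesis using L(1) by (simp add: onorm_zero)
  qed
  with L(1) show thesis by (rule that)
qed

text \<open>If \<open>t\<close> times the Lipschitz constant \<open>L\<close> of \<open>f\<close> is below \<open>1\<close>, then \<open>x \<mapsto> x - t *\<^sub>R f x\<close> is injective, and a
  preimage of \<open>y\<close> is the fixed point of the contraction \<open>x \<mapsto> y + t *\<^sub>R f x\<close>. Since the map is the
  identity outside the ball, it permutes the ball, and the claim is a change of variables; the Jacobian determinant
  equals its absolute value by \<open>det_id_minus_pos\<close>.\<close>

lemma integral_of_small_perturbation:
  obtains e where "0 < e"
    "\<And>t \<phi>. \<lbrakk>0 < t; t < e; continuous_on UNIV \<phi>\<rbrakk> \<Longrightarrow>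
      integral (cball 0 R) (\<lambda>x. det (matrix (\<lambda>v. v - t *\<^sub>R D x v)) * \<phi> (x - t *\<^sub>R f x)) =
      integral (cball 0 R) \<phi>"
proof -
  obtain L where L: "0 < L" "\<And>x. onorm (D x) \<le> L"
    using bounded_derivative by blast
  have lip: "norm (f x - f y) \<le> L * norm (x - y)" for x y
    using differentiable_bound[of UNIV f D L x y] has_derivative_f L(2) by simp
  show thesis
  proof (rule that)
    show "0 < 1 / L" using L(1) by simp
  next
    fix t :: real and \<phi> :: "real^'m::_ \<Rightarrow> real"
    assume t: "0 < t" "t < 1 / L" and \<phi>: "continuous_on UNIV \<phi>"
    define g where "g x = x - t *\<^sub>R f x" for x
    have tL: "t * L < 1" "0 \<le> t * L"
      using t L(1) by (auto simp: field_simps)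
    have contr: "dist (t *\<^sub>R f x) (t *\<^sub>R f y) \<le> t * L * dist x y" for x y
      using mult_left_mono[OF lip[of x y], of t] t(1)
      by (simp add: dist_norm mult.assoc flip: scaleR_diff_right)
    have inj: "inj g"
    proof
      fix x y assume "g x = g y"
      then have "x - y = t *\<^sub>R f x - t *\<^sub>R f y"
        by (simp add: g_def algebra_simps)
      then have "dist x y \<le> t * L * dist x y"
        using contr[of x y] by (simp add: dist_norm)
      then have "(1 - t * L) * dist x y \<le> 0" by (simp add: algebra_simps)
      then show "x = y"
        using tL by (simp add: mult_le_0_iff)
    qed
    have img: "g ` cball 0 R = cball 0 R"
    proof (intro equalityI subsetI)
      fix y assume "y \<in> g ` cball 0 R"
      then obtain x where x: "x \<in> cball 0 R" "y = g x" by blast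
      \<comment> \<open>A point outside the ball is its own image, so it cannot also be the image of a point inside.\<close>
      show "y \<in> cball 0 R"
      proof (rule ccontr)
        assume *: "y \<notin> cball 0 R"
        then have "g y = g x" using x vanishes[of y] by (simp add: g_def)
        with inj have "y = x" by (meson injD)
        with * x(1) show False by simp
      qed
    next
      fix y assume y: "y \<in> cball (0::real^'m::_) R"
      have "\<exists>!x. y + t *\<^sub>R f x = x"
        using tL contr by (intro banach_fix_type[of "t * L"]) auto
      then obtain x where x: "y + t *\<^sub>R f x = x" by blast
      then have "x \<in> cball 0 R"
        using vanishes[of x] y by (cases "R \<le> norm x") auto
      with x show "y \<in> g ` cball 0 R"
        by (intro image_eqI[of _ _ x]) (auto simp: g_def algebra_simps)
    qed
    have pos: "0 < det (matrix (\<lambda>v. v - t *\<^sub>R D x v))" for x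
    proof (rule det_id_minus_pos)
      show "linear (\<lambda>v. t *\<^sub>R D x v)"
        using linear_D by (rule linear_compose_scale_right)
    next
      fix s v assume s: "0 \<le> s" "s \<le> 1" "v = s *\<^sub>R t *\<^sub>R D x v"
      have "norm (D x v) \<le> L * norm v"
        using onorm[OF has_derivative_bounded_linear[OF has_derivative_f], of x v] L(2)[of x]
        by (meson mult_right_mono norm_ge_zero order_trans)
      then have "s * t * norm (D x v) \<le> 1 * t * (L * norm v)"
        using s t(1) by (intro mult_mono) auto
      moreover have "norm v = s * t * norm (D x v)"
        using s t by (metis abs_of_nonneg less_imp_le mult.assoc norm_scaleR)
      ultimately have "(1 - t * L) * norm v \<le> 0" by (simp add: algebra_simps)
      then show "v = 0"
        using tL by (simp add: mult_le_0_iff)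
    qed
    have "integral (cball 0 R) (\<lambda>x. \<bar>det (matrix (\<lambda>v. v - t *\<^sub>R D x v))\<bar> * \<phi> (g x)) =
      integral (g ` cball 0 R) \<phi>"
    proof (rule integral_change_of_variables_compact)
      show "(g has_derivative (\<lambda>v. v - t *\<^sub>R D x v)) (at x within cball 0 R)" for x
        unfolding g_def by (rule has_derivative_id_minus)
    qed (auto intro: inj_on_subset[OF inj] continuous_on_subset[OF \<phi>])
    then show "integral (cball 0 R) (\<lambda>x. det (matrix (\<lambda>v. v - t *\<^sub>R D x v)) * \<phi> (x - t *\<^sub>R f x)) =
      integral (cball 0 R) \<phi>"
      using pos unfolding img by (simp add: g_def abs_of_pos)
  qed
qed

text \<open>Both sides are values, at \<open>t = 1\<close> and for small \<open>t\<close>, of one polynomial in \<open>t\<close>. Polynomials enter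
  here because only for them is \<open>p (x - t *\<^sub>R f x)\<close> polynomial in \<open>t\<close>; the second factor is one because a
  determinant is polynomial in its entries.\<close>

lemma integral_of_polynomial:
  assumes p: "real_polynomial_function p"
  shows "integral (cball 0 R) (\<lambda>x. det (matrix (\<lambda>v. v - D x v)) * p (x - f x)) = integral (cball 0 R) p"
proof -
  have entries: "polynomial_in_parameter (cball 0 R) (\<lambda>t x. matrix (\<lambda>v. v - t *\<^sub>R D x v) $ i $ j)" for i j
  proof -
    have "polynomial_in_parameter (cball 0 R) (\<lambda>t x. axis j 1 $ i + t * (- (D x (axis j 1) $ i)))"
      by (intro polynomial_in_parameter_affine continuous_intros continuous_on_subset[OF continuous_D]) auto
    then show ?thesis by (simp add: matrix_def)
  qed
  have "polynomial_in_parameter (cball 0 R)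
      (\<lambda>t x. det (matrix (\<lambda>v. v - t *\<^sub>R D x v)) * p (x - t *\<^sub>R f x))"
    by (rule polynomial_in_parameter_mult[OF polynomial_in_parameter_det[OF entries]
          polynomial_in_parameter_real_polynomial_function[OF p continuous_f]])
  from polynomial_in_parameter_integral[OF compact_cball this] obtain Q where Q: "\<And>t. integral (cball 0 R)
      (\<lambda>x. det (matrix (\<lambda>v. v - t *\<^sub>R D x v)) * p (x - t *\<^sub>R f x)) = poly Q t"
    by blast
  have cp: "continuous_on UNIV p"
    using p continuous_on_polymonial_function real_polynomial_function_eq by blast
  obtain e where e: "0 < e"
    "\<And>t \<phi>. \<lbrakk>0 < t; t < e; continuous_on UNIV \<phi>\<rbrakk> \<Longrightarrow>
      integral (cball 0 R) (\<lambda>x. det (matrix (\<lambda>v. v - t *\<^sub>R D x v)) * \<phi> (x - t *\<^sub>R f x)) =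
      integral (cball 0 R) \<phi>"
    by (rule integral_of_small_perturbation) blast
  have "\<And>t. \<lbrakk>0 < t; t < e\<rbrakk> \<Longrightarrow> poly Q t = integral (cball 0 R) p"
    using e(2)[OF _ _ cp] Q by simp
  with e(1) have "poly Q 1 = integral (cball 0 R) p"
    by (rule poly_eq_if_constant_near_0)
  with Q[of 1] show ?thesis by simp
qed

text \<open>The formula says that \<open>x \<mapsto> x - f x\<close> has degree \<open>1\<close>. Both sides depend continuously, in the
  supremum norm, on the values of \<open>\<phi>\<close> on the compact set \<open>K\<close>, on which polynomials are dense.\<close>

lemma integral_of_continuous:
  fixes \<phi> :: "real^'m::_ \<Rightarrow> real"
  assumes \<phi>: "continuous_on UNIV \<phi>"
  shows "integral (cball 0 R) (\<lambda>x. det (matrix (\<lambda>v. v - D x v)) * \<phi> (x - f x)) = integral (cball 0 R) \<phi>"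
    (is "?I \<phi> = integral ?B \<phi>")
proof -
  define d where "d x = det (matrix (\<lambda>v. v - D x v))" for x
  define K where "K = ?B \<union> (\<lambda>x. x - f x) ` ?B"
  have cd: "continuous_on ?B d"
    unfolding d_def using continuous_jacobian_determinant[of ?B 1] by simp
  have cg: "continuous_on ?B (\<lambda>x. \<psi> (x - f x))" if "continuous_on UNIV \<psi>" for \<psi> :: "real^'m::_ \<Rightarrow> real"
    by (rule continuous_on_compose2[OF that]) (auto intro!: continuous_intros continuous_f)
  have i: "(\<lambda>x. d x * \<psi> (x - f x)) integrable_on ?B" "\<psi> integrable_on ?B"
    if "continuous_on UNIV \<psi>" for \<psi> :: "real^'m::_ \<Rightarrow> real"
    using that
    by (intro integrable_on_compact continuous_on_mult cd cg; force intro: continuous_on_subset)+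
  have K: "compact K"
    unfolding K_def by (intro compact_Un compact_continuous_image continuous_intros continuous_f) auto
  define C where "C = integral ?B (\<lambda>x. \<bar>d x\<bar> + 1)"
  have "0 \<le> C"
    unfolding C_def by (intro integral_nonneg integrable_on_compact continuous_intros cd) auto
  have close: "\<bar>?I \<phi> - integral ?B \<phi>\<bar> \<le> C * e" if e: "0 < e" for e
  proof -
    obtain p where p: "real_polynomial_function p" "\<And>x. x \<in> K \<Longrightarrow> \<bar>\<phi> x - p x\<bar> < e"
      using Stone_Weierstrass_real_polynomial_function[OF K continuous_on_subset[OF \<phi>] e] by auto
    have cp: "continuous_on UNIV p"
      using p(1) continuous_on_polymonial_function real_polynomial_function_eq by blast
    have "?I \<phi> - integral ?B \<phi> = (?I \<phi> - ?I p) - (integral ?B \<phi> - integral ?B p)"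
      using integral_of_polynomial[OF p(1)] by simp
    also have "\<dots> = integral ?B (\<lambda>x. (d x * \<phi> (x - f x) - d x * p (x - f x)) - (\<phi> x - p x))"
      unfolding d_def[symmetric]
      using i[OF \<phi>] i[OF cp] by (simp add: integral_diff integrable_diff)
    also have "\<bar>\<dots>\<bar> \<le> integral ?B (\<lambda>x. (\<bar>d x\<bar> + 1) * e)"
    proof (rule integral_norm_bound_integral[where 'a=real, simplified])
      fix x assume x: "x \<in> ?B"
      have "\<bar>d x * \<phi> (x - f x) - d x * p (x - f x)\<bar> \<le> \<bar>d x\<bar> * e"
        using p(2)[of "x - f x"] x
        by (auto simp: K_def abs_mult mult_left_mono simp flip: right_diff_distrib)
      moreover have "\<bar>\<phi> x - p x\<bar> \<le> e"
        using p(2)[of x] x by (simp add: K_def)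
      ultimately show "\<bar>d x * \<phi> (x - f x) - d x * p (x - f x) - (\<phi> x - p x)\<bar> \<le> (\<bar>d x\<bar> + 1) * e"
        by (simp add: algebra_simps)
    next
      show "(\<lambda>x. (\<bar>d x\<bar> + 1) * e) integrable_on ?B"
        by (intro integrable_on_compact continuous_intros cd) auto
    qed (intro integrable_diff i \<phi> cp)
    also have "\<dots> = C * e" by (simp add: C_def)
    finally show ?thesis .
  qed
  have "\<bar>?I \<phi> - integral ?B \<phi>\<bar> \<le> 0 + e" if "0 < e" for e
  proof -
    have "C * (e / (C + 1)) \<le> e"
      using that \<open>0 \<le> C\<close> by (simp add: field_simps)
    with close[of "e / (C + 1)"] that \<open>0 \<le> C\<close> show ?thesis by simp
  qed
  then have "\<bar>?I \<phi> - integral ?B \<phi>\<bar> \<le> 0"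
    by (rule field_le_epsilon)
  then show ?thesis by simp
qed

section \<open>Two fixed points would contribute twice to the degree formula\<close>

text \<open>The inverse function theorem, in the form used for the lower bound: arbitrarily close to a
  nondegenerate zero of \<open>x \<mapsto> x - f x\<close> there is a compact set mapped bijectively onto a whole small ball
  around \<open>0\<close>.\<close>

lemma local_preimage_of_small_ball:
  assumes p: "f p = p" and nz: "det (matrix (\<lambda>v. v - D p v)) \<noteq> 0" and W: "open W" "p \<in> W"
  obtains s where "0 < s"
    "\<And>r. \<lbrakk>0 < r; r < s\<rbrakk> \<Longrightarrow> \<exists>S\<subseteq>W. compact S \<and> inj_on (\<lambda>x. x - f x) S \<and> (\<lambda>x. x - f x) ` S = cball 0 r"
proof -
  define G where "G x = Blinfun (\<lambda>v. v - D x v)" for x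
  have G: "blinfun_apply (G x) = (\<lambda>v. v - D x v)" for x
    unfolding G_def
    by (intro bounded_linear_Blinfun_apply bounded_linear_sub bounded_linear_ident
        has_derivative_bounded_linear[OF has_derivative_f])
  have lin: "linear (\<lambda>v. v - D p v)"
    by (intro linear_compose_sub linear_ident linear_D)
  with nz have "inj (\<lambda>v. v - D p v)"
    using det_nz_iff_inj by blast
  with lin obtain h where h: "linear h" "h \<circ> (\<lambda>v. v - D p v) = id"
    using linear_injective_left_inverse by blast
  have "Blinfun h o\<^sub>L G p = id_blinfun"
  proof (rule blinfun_eqI)
    show "blinfun_apply (Blinfun h o\<^sub>L G p) v = blinfun_apply id_blinfun v" for v
      using h by (simp add: G bounded_linear_Blinfun_apply linear_linear o_def id_def fun_eq_iff)
  qed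
  moreover have "continuous_on W G"
  proof (rule continuous_on_blinfun_componentwise)
    show "continuous_on W (\<lambda>x. blinfun_apply (G x) i)" for i
      unfolding G by (intro continuous_intros continuous_on_subset[OF continuous_D]) auto
  qed
  moreover have "((\<lambda>x. x - f x) has_derivative blinfun_apply (G x)) (at x)" for x
    unfolding G using has_derivative_id_minus[of 1 x UNIV] by simp
  ultimately obtain U V h' where U: "open U" "U \<subseteq> W" "p \<in> U" "open V" "p - f p \<in> V"
      and hom: "homeomorphism U V (\<lambda>x. x - f x) h'"
    using inverse_function_theorem[of W "\<lambda>x. x - f x" G p "Blinfun h"] W by metis
  then obtain s where s: "0 < s" "ball 0 s \<subseteq> V"
    using p by (metis diff_self openE)
  show thesis
  proof (rule that[OF s(1)])
    fix r :: real assume "0 < r" "r < s"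
    then have sub: "cball 0 r \<subseteq> V" using s(2) by (auto simp: subset_iff)
    have "h' ` cball 0 r \<subseteq> U"
      using hom sub by (auto simp: homeomorphism_def)
    moreover have "compact (h' ` cball 0 r)"
      using hom sub by (intro compact_continuous_image) (auto simp: homeomorphism_def intro: continuous_on_subset)
    moreover have "h' y - f (h' y) = y" if "y \<in> cball 0 r" for y
      using hom sub that by (auto simp: homeomorphism_def)
    then have "(\<lambda>x. x - f x) ` h' ` cball 0 r = cball 0 r"
      unfolding image_image by (intro image_cong[THEN trans[OF _ image_ident]] refl)
    moreover have "inj_on (\<lambda>x. x - f x) U"
      using hom by (intro inj_on_inverseI[of _ h']) (auto simp: homeomorphism_def)
    ultimately show "\<exists>S\<subseteq>W. compact S \<and> inj_on (\<lambda>x. x - f x) S \<and> (\<lambda>x. x - f x) ` S = cball 0 r"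
      using U(2) inj_on_subset[of "\<lambda>x. x - f x" U "h' ` cball 0 r"]
      by (intro exI[of _ "h' ` cball 0 r"]) blast
  qed
qed

text \<open>The zeros of \<open>g\<close> have positive Jacobian determinant, and by compactness so has every point of the
  ball at which \<open>g\<close> is smaller than some \<open>\<epsilon>\<close>. With \<open>\<phi>\<close> supported in a ball of radius \<open>r < \<epsilon>\<close>, the integrand
  of the degree formula is nonnegative, so its integral is bounded below by the one over disjoint
  neighbourhoods of two zeros.\<close>

lemma fixed_point_unique:
  assumes nondeg: "\<And>p. f p = p \<Longrightarrow> 0 < det (matrix (\<lambda>v. v - D p v))"
    and a: "f a = a" and b: "f b = b"
  shows "a = b"
proof (rule ccontr)
  assume "a \<noteq> b"
  define g where "g x = x - f x" for x
  define d where "d x = det (matrix (\<lambda>v. v - D x v))" for x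
  define B where "B = cball (0::real^'m::_) R"
  have cd: "continuous_on S d" for S
    unfolding d_def using continuous_jacobian_determinant[of S 1] by simp
  have cg: "continuous_on S g" for S
    unfolding g_def by (intro continuous_intros continuous_f)
  have compact_B: "compact B" by (simp add: B_def)

  have "\<exists>\<epsilon>>0. \<forall>x\<in>B. norm (g x) < \<epsilon> \<longrightarrow> 0 < d x"
  proof -
    define Z where "Z = g ` (B \<inter> {x. d x \<le> 0})"
    have "closed {x. d x \<le> 0}"
      by (rule closed_Collect_le[OF cd continuous_on_const])
    then have "closed Z"
      unfolding Z_def
      by (rule compact_imp_closed[OF compact_continuous_image[OF cg compact_Int_closed[OF compact_B]]])
    moreover have "0 \<notin> Z"
    proof
      assume "0 \<in> Z"
      then obtain x where "g x = 0" "d x \<le> 0" by (force simp: Z_def)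
      then have "f x = x" unfolding g_def by (metis eq_iff_diff_eq_0)
      then show False using nondeg[of x] \<open>d x \<le> 0\<close> by (simp add: d_def)
    qed
    ultimately obtain \<epsilon> where "0 < \<epsilon>" and *: "\<And>y. y \<in> Z \<Longrightarrow> \<epsilon> \<le> dist 0 y"
      using separate_point_closed[of Z 0] by auto
    have "0 < d x" if "x \<in> B" "norm (g x) < \<epsilon>" for x
    proof (rule ccontr)
      assume "\<not> 0 < d x"
      with that(1) have "g x \<in> Z" by (simp add: Z_def)
      then have "\<epsilon> \<le> dist 0 (g x)" by (rule *)
      with that(2) show False by simp
    qed
    with \<open>0 < \<epsilon>\<close> show ?thesis by blast
  qed
  then obtain \<epsilon> where \<epsilon>: "0 < \<epsilon>" "\<And>x. \<lbrakk>x \<in> B; norm (g x) < \<epsilon>\<rbrakk> \<Longrightarrow> 0 < d x"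
    by blast

  define \<delta> where "\<delta> = dist a b / 2"
  have \<delta>: "0 < \<delta>" "ball a \<delta> \<inter> ball b \<delta> = {}"
    using \<open>a \<noteq> b\<close> disjoint_ballI[of \<delta> \<delta> a b] by (simp_all add: \<delta>_def)
  have inR: "norm p < R" if "f p = p" for p
    using vanishes[of p] that R_pos by (cases "R \<le> norm p") auto
  obtain s where s: "0 < s" "\<And>r. \<lbrakk>0 < r; r < s\<rbrakk> \<Longrightarrow>
      \<exists>S\<subseteq>ball a \<delta> \<inter> ball 0 R. compact S \<and> inj_on g S \<and> g ` S = cball 0 r"
    unfolding g_def
    by (rule local_preimage_of_small_ball[OF a, of "ball a \<delta> \<inter> ball 0 R"])
       (use nondeg[OF a] \<delta> inR[OF a] in auto)
  obtain s' where s': "0 < s'" "\<And>r. \<lbrakk>0 < r; r < s'\<rbrakk> \<Longrightarrow>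
      \<exists>S\<subseteq>ball b \<delta> \<inter> ball 0 R. compact S \<and> inj_on g S \<and> g ` S = cball 0 r"
    unfolding g_def
    by (rule local_preimage_of_small_ball[OF b, of "ball b \<delta> \<inter> ball 0 R"])
       (use nondeg[OF b] \<delta> inR[OF b] in auto)
  \<comment> \<open>\<open>r < R\<close> puts the support of \<open>\<phi>\<close> inside \<open>B\<close>, so that integrating \<open>\<phi>\<close> over \<open>B\<close> yields a single copy.\<close>
  define r where "r = min (min s s') (min \<epsilon> R) / 2"
  have r: "0 < r" "r < s" "r < s'" "r < \<epsilon>" "r < R"
    using s(1) s'(1) \<epsilon>(1) R_pos by (auto simp: r_def)
  obtain S where S: "S \<subseteq> ball a \<delta> \<inter> ball 0 R" "compact S" "inj_on g S" "g ` S = cball 0 r"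
    using s(2)[OF r(1,2)] by blast
  obtain T where T: "T \<subseteq> ball b \<delta> \<inter> ball 0 R" "compact T" "inj_on g T" "g ` T = cball 0 r"
    using s'(2)[OF r(1,3)] by blast

  define \<phi> where "\<phi> y = max 0 (r - norm y)" for y :: "real^'m::_"
  have c\<phi>: "continuous_on X \<phi>" for X
    unfolding \<phi>_def by (intro continuous_intros)
  have c: "continuous_on X (\<lambda>x. d x * \<phi> (g x))" for X
    by (intro continuous_intros cd continuous_on_compose2[OF c\<phi>[of UNIV] cg]) auto
  have block: "integral X (\<lambda>x. d x * \<phi> (g x)) = integral (cball 0 r) \<phi>"
    if X: "X \<subseteq> ball 0 R" "compact X" "inj_on g X" "g ` X = cball 0 r" for X
  proof -
    have "\<bar>d x\<bar> = d x" if "x \<in> X" for x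
    proof -
      have "g x \<in> cball 0 r" using X(4) that by blast
      then have "norm (g x) < \<epsilon>" using r by auto
      moreover have "x \<in> B" using that X(1) by (auto simp: B_def)
      ultimately show ?thesis using \<epsilon>(2)[of x] by simp
    qed
    then have "integral X (\<lambda>x. d x * \<phi> (g x)) = integral X (\<lambda>x. \<bar>d x\<bar> * \<phi> (g x))"
      by (intro integral_cong) simp
    also have "\<dots> = integral (g ` X) \<phi>"
      unfolding d_def
    proof (rule integral_change_of_variables_compact)
      show "(g has_derivative (\<lambda>v. v - D x v)) (at x within X)" for x
        unfolding g_def using has_derivative_id_minus[of 1 x X] by simp
    qed (use X c\<phi> in auto)
    finally show ?thesis using X(4) by simp
  qed
  have nonneg: "0 \<le> d x * \<phi> (g x)" if "x \<in> B" for x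
    using \<epsilon>(2)[OF that] r by (cases "norm (g x) < \<epsilon>") (auto simp: \<phi>_def)

  have "2 * integral (cball 0 r) \<phi> = integral (S \<union> T) (\<lambda>x. d x * \<phi> (g x))"
  proof -
    have "S \<inter> T = {}" using S(1) T(1) \<delta>(2) by blast
    then show ?thesis
      using S T by (subst integral_Un) (auto simp: block intro!: integrable_on_compact c)
  qed
  also have "\<dots> \<le> integral B (\<lambda>x. d x * \<phi> (g x))"
    using S(1,2) T(1,2) nonneg
    by (intro integral_subset_le integrable_on_compact compact_Un compact_B c) (auto simp: B_def)
  also have "\<dots> = integral B \<phi>"
    using integral_of_continuous[OF c\<phi>[of UNIV]] by (simp add: B_def d_def g_def)
  also have "\<dots> = integral (cball 0 r) \<phi>"
  proof (rule integral_spike_set)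
    show "negligible {x \<in> B - cball 0 r. \<phi> x \<noteq> 0}"
      by (rule negligible_subset[OF negligible_empty]) (auto simp: \<phi>_def)
    show "negligible {x \<in> cball 0 r - B. \<phi> x \<noteq> 0}"
      using r by (intro negligible_subset[OF negligible_empty]) (auto simp: B_def)
  qed
  finally have "integral (cball 0 r) \<phi> \<le> 0" by simp
  \<comment> \<open>On the ball of half the radius \<open>\<phi>\<close> is at least \<open>r / 2\<close>.\<close>
  moreover have "0 < integral (cball 0 r) \<phi>"
  proof -
    have "0 < r / 2 * measure lebesgue (cball (0::real^'m::_) (r / 2))"
      using r by (intro mult_pos_pos) (auto simp: content_cball_conv_ball content_ball_pos)
    also have "\<dots> = integral (cball (0::real^'m::_) (r / 2)) (\<lambda>x. r / 2)"
      using integral_mult_right[of "cball (0::real^'m::_) (r / 2)" "r / 2" "\<lambda>_. 1"]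
        lmeasure_integral[OF lmeasurable_cball, of "0::real^'m::_" "r / 2"]
      by simp
    also have "\<dots> \<le> integral (cball 0 (r / 2)) \<phi>"
      by (intro integral_le integrable_on_compact c\<phi>) (auto simp: \<phi>_def max_def)
    also have "\<dots> \<le> integral (cball 0 r) \<phi>"
      using r by (intro integral_subset_le integrable_on_compact c\<phi>) (auto simp: \<phi>_def)
    finally show ?thesis .
  qed
  ultimately show False by simp
qed

end

section \<open>Reduction of bounded maps to compactly supported ones\<close>

text \<open>The difference quotient is within \<open>\<bar>t - s\<bar>\<close> of the claimed derivative, whatever the signs of \<open>s\<close> and
  \<open>t\<close>; this covers the kink of the positive part at \<open>s = 0\<close> as well.\<close>

lemma square_positive_part_has_real_derivative:
  "((\<lambda>s. (max 0 s)\<^sup>2) has_real_derivative 2 * max 0 s) (at (s::real))"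
proof -
  have "\<bar>((max 0 t)\<^sup>2 - (max 0 s)\<^sup>2) / (t - s) - 2 * max 0 s\<bar> \<le> \<bar>t - s\<bar>" if "t \<noteq> s" for t :: real
  proof -
    have "\<bar>(max 0 t)\<^sup>2 - (max 0 s)\<^sup>2 - 2 * max 0 s * (t - s)\<bar> \<le> (t - s)\<^sup>2"
    proof -
      consider "0 \<le> s" "0 \<le> t" | "0 \<le> s" "t \<le> 0" | "s \<le> 0" "0 \<le> t" | "s \<le> 0" "t \<le> 0"
        by linarith
      then show ?thesis
      proof cases
        case 1
        then have "(max 0 t)\<^sup>2 - (max 0 s)\<^sup>2 - 2 * max 0 s * (t - s) = (t - s)\<^sup>2"
          by (simp add: power2_eq_square algebra_simps)
        then show ?thesis by simp
      next
        case 2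
        then have "(max 0 t)\<^sup>2 - (max 0 s)\<^sup>2 - 2 * max 0 s * (t - s) = s\<^sup>2 - 2 * (s * t)"
          by (simp add: power2_eq_square algebra_simps)
        moreover have "s * t \<le> 0" using 2 by (rule mult_nonneg_nonpos)
        moreover have "(t - s)\<^sup>2 = t\<^sup>2 + (s\<^sup>2 - 2 * (s * t))"
          by (simp add: power2_diff)
        ultimately show ?thesis
          using zero_le_power2[of s] zero_le_power2[of t] by linarith
      next
        case 3
        then have "(max 0 t)\<^sup>2 - (max 0 s)\<^sup>2 - 2 * max 0 s * (t - s) = t\<^sup>2" by simp
        moreover have "s * t \<le> 0" using 3 by (rule mult_nonpos_nonneg)
        moreover have "(t - s)\<^sup>2 = t\<^sup>2 + (s\<^sup>2 - 2 * (s * t))"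
          by (simp add: power2_diff)
        ultimately show ?thesis
          using zero_le_power2[of s] zero_le_power2[of t] by linarith
      qed simp
    qed
    then have "\<bar>((max 0 t)\<^sup>2 - (max 0 s)\<^sup>2 - 2 * max 0 s * (t - s)) / (t - s)\<bar> \<le> \<bar>t - s\<bar>"
      unfolding abs_divide using that by (simp add: pos_divide_le_eq flip: power2_eq_square)
    then show ?thesis using that by (simp add: diff_divide_distrib)
  qed
  moreover have "(\<lambda>t. \<bar>t - s\<bar>) \<midarrow>s\<rightarrow> 0"
    by (rule tendsto_rabs_zero[OF LIM_zero[OF tendsto_ident_at]])
  ultimately have "(\<lambda>t. ((max 0 t)\<^sup>2 - (max 0 s)\<^sup>2) / (t - s) - 2 * max 0 s) \<midarrow>s\<rightarrow> 0"
    using Lim_null_comparison[where f = "\<lambda>t. ((max 0 t)\<^sup>2 - (max 0 s)\<^sup>2) / (t - s) - 2 * max 0 s"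
        and g = "\<lambda>t. \<bar>t - s\<bar>" and net = "at s"]
    by (simp add: eventually_at_filter)
  then have "(\<lambda>t. ((max 0 t)\<^sup>2 - (max 0 s)\<^sup>2) / (t - s)) \<midarrow>s\<rightarrow> 2 * max 0 s"
    by (rule LIM_zero_cancel)
  then show ?thesis
    by (simp add: has_field_derivative_iff)
qed

text \<open>With \<open>q s = (max 0 s)\<^sup>2\<close>, the function \<open>q (1 - q u)\<close> is \<open>C\<^sup>1\<close>, equals \<open>1\<close> for \<open>u \<le> 0\<close> and vanishes for
  \<open>u \<ge> 1\<close>. Inserting \<open>u = (norm x / r)\<^sup>2 - 1\<close> gives a cutoff.\<close>

lemma C1_cutoff:
  fixes r :: real
  assumes r: "0 < r"
  obtains h :: "'a::euclidean_space \<Rightarrow> real" and H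
  where "\<And>x. (h has_derivative H x) (at x)" "\<And>v. continuous_on UNIV (\<lambda>x. H x v)"
    "\<And>x. 0 \<le> h x" "\<And>x. h x \<le> 1"
    "\<And>x. norm x \<le> r \<Longrightarrow> h x = 1" "\<And>x. 2 * r \<le> norm x \<Longrightarrow> h x = 0"
proof -
  define q where "q s = (max 0 s)\<^sup>2" for s :: real
  define k where "k = 1 / r\<^sup>2"
  define u where "u x = k * (x \<bullet> x) - 1" for x :: 'a
  define h where "h x = q (1 - q (u x))" for x :: 'a
  define H where "H x v = 2 * k * (x \<bullet> v) * (- (2 * max 0 (u x))) * (2 * max 0 (1 - q (u x)))"
    for x v :: 'a
  have q_deriv: "(q has_real_derivative 2 * max 0 s) (at s)" for s
    unfolding q_def by (rule square_positive_part_has_real_derivative)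
  have u: "(u has_derivative (\<lambda>v. 2 * k * (x \<bullet> v))) (at x)" for x
    unfolding u_def by (auto intro!: derivative_eq_intros simp: inner_commute algebra_simps)
  have "((\<lambda>x. 1 - q (u x)) has_derivative (\<lambda>v. 2 * k * (x \<bullet> v) * (- (2 * max 0 (u x))))) (at x)" for x
    using has_derivative_diff[OF has_derivative_const DERIV_compose_FDERIV[OF q_deriv u, of x]]
    by simp
  then have "(h has_derivative H x) (at x)" for x
    unfolding h_def H_def using DERIV_compose_FDERIV[OF q_deriv] by blast
  moreover have "continuous_on UNIV (\<lambda>x. H x v)" for v
    unfolding H_def u_def q_def by (intro continuous_intros)
  moreover have "0 \<le> h x" "h x \<le> 1" for x
    by (auto simp: h_def q_def power_le_one)
  moreover have "h x = 1" if "norm x \<le> r" for x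
  proof -
    have "u x \<le> 0"
      using that r by (simp add: u_def k_def dot_square_norm power_mono)
    then show ?thesis by (simp add: h_def q_def)
  qed
  moreover have "h x = 0" if "2 * r \<le> norm x" for x
  proof -
    have "2 * r\<^sup>2 \<le> (2 * r)\<^sup>2"
      by (simp add: power_mult_distrib)
    also have "\<dots> \<le> x \<bullet> x"
      unfolding dot_square_norm using that r by (intro power_mono) auto
    finally have "2 * r\<^sup>2 \<le> x \<bullet> x" .
    then have "1 \<le> u x"
      using r by (simp add: u_def k_def field_simps)
    then have "1 \<le> q (u x)"
      by (simp add: q_def)
    then show ?thesis by (simp add: h_def q_def)
  qed
  ultimately show thesis by (rule that)
qed

text \<open>Multiplying \<open>f\<close> by a cutoff \<open>h\<close> that is \<open>1\<close> on a ball containing the range of \<open>f\<close> creates no new fixed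
  point: \<open>norm p = h p * norm (f p)\<close> forces \<open>p\<close> into the open ball, where \<open>f\<close> is unchanged.\<close>

lemma fixed_point_unique_wellorder:
  fixes f :: "real^'m::{finite,wellorder} \<Rightarrow> real^'m::_"
  assumes f: "\<And>x. (f has_derivative D x) (at x)"
    and D: "\<And>v. continuous_on UNIV (\<lambda>x. D x v)"
    and bdd: "bounded (range f)"
    and nondeg: "\<And>p s v. \<lbrakk>f p = p; 0 \<le> s; s \<le> 1; v = s *\<^sub>R D p v\<rbrakk> \<Longrightarrow> v = 0"
    and "f a = a" "f b = b"
  shows "a = b"
proof -
  obtain r where r: "0 < r" "\<And>x. norm (f x) < r"
    using bdd by (auto simp: bounded_pos_less)
  obtain h :: "real^'m::_ \<Rightarrow> real" and H
    where h: "\<And>x. (h has_derivative H x) (at x)" "\<And>v. continuous_on UNIV (\<lambda>x. H x v)"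
      "\<And>x. 0 \<le> h x" "\<And>x. h x \<le> 1"
      "\<And>x. norm x \<le> r \<Longrightarrow> h x = 1" "\<And>x. 2 * r \<le> norm x \<Longrightarrow> h x = 0"
    by (rule C1_cutoff[OF r(1)]) (rule that)
  define F where "F x = h x *\<^sub>R f x" for x
  define DF where "DF x v = h x *\<^sub>R D x v + H x v *\<^sub>R f x" for x v
  have cont: "continuous_on UNIV h" "continuous_on UNIV f"
    by (rule has_derivative_continuous_on[OF has_derivative_at_withinI[OF h(1)]])
       (rule has_derivative_continuous_on[OF has_derivative_at_withinI[OF f]])
  have F: "(F has_derivative DF x) (at x)" for x
    unfolding F_def DF_def by (rule has_derivative_scaleR[OF h(1) f])
  interpret compactly_supported_C1 F DF "2 * r"
  proof
    show "continuous_on UNIV (\<lambda>x. DF x v)" for v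
      unfolding DF_def by (intro continuous_intros cont D h(2))
    show "F x = 0" if "2 * r \<le> norm x" for x
      using h(6)[OF that] by (simp add: F_def)
  qed (use r F in auto)
  have F_eq: "F x = f x" if "x \<in> ball 0 r" for x
    using h(5)[of x] that by (simp add: F_def)
  show ?thesis
  proof (rule fixed_point_unique)
    show "F a = a" "F b = b"
      using F_eq[of a] F_eq[of b] r(2)[of a] r(2)[of b] \<open>f a = a\<close> \<open>f b = b\<close> by auto
  next
    fix p assume "F p = p"
    then have "norm p = h p * norm (f p)"
      using h(3)[of p] by (metis F_def abs_of_nonneg norm_scaleR)
    also have "\<dots> \<le> norm (f p)"
      using h(3,4)[of p] by (simp add: mult_left_le_one_le)
    finally have p: "p \<in> ball 0 r"
      using r(2)[of p] by simp
    have "(F has_derivative D p) (at p)"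
      using F_eq by (intro has_derivative_transform_within_open[OF f _ p]) auto
    then have "DF p = D p"
      using F has_derivative_unique by blast
    moreover have "f p = p"
      using F_eq[OF p] \<open>F p = p\<close> by simp
    then have "0 < det (matrix (\<lambda>v. v - D p v))"
      using has_derivative_linear[OF f] nondeg by (intro det_id_minus_pos) blast+
    ultimately show "0 < det (matrix (\<lambda>v. v - DF p v))"
      by simp
  qed
qed

section \<open>Arbitrary Euclidean spaces\<close>

text \<open>A well-ordered finite index type with \<^term>\<open>DIM('a::euclidean_space)\<close> elements, so that
  \<^typ>\<open>'a::euclidean_space\<close> is isomorphic to the vectors indexed by it.\<close>

typedef (overloaded) ('a::euclidean_space) coordinate = "{..<DIM('a)}"
  by (rule exI[of _ 0]) simp

instantiation coordinate :: (euclidean_space) wellorder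
begin

definition "i \<le> j \<longleftrightarrow> Rep_coordinate i \<le> Rep_coordinate j"
definition "i < j \<longleftrightarrow> Rep_coordinate i < Rep_coordinate j"

instance
proof
  fix P :: "'a coordinate \<Rightarrow> bool" and i :: "'a coordinate"
  assume "\<And>i. (\<And>j. j < i \<Longrightarrow> P j) \<Longrightarrow> P i"
  then show "P i"
    unfolding less_coordinate_def by (rule measure_induct_rule)
qed (auto simp: less_eq_coordinate_def less_coordinate_def Rep_coordinate_inject)

end

instance coordinate :: (euclidean_space) finite
proof
  show "finite (UNIV :: 'a coordinate set)"
    by (metis finite_imageI finite_lessThan type_definition.univ type_definition_coordinate)
qed

lemma CARD_coordinate: "CARD('a::euclidean_space coordinate) = DIM('a)"
  using type_definition.card[OF type_definition_coordinate] by simp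

text \<open>The last hypothesis says that the derivative at a fixed point has no real eigenvalue in
  \<open>{1..}\<close>, with \<open>s\<close> as the inverse of the eigenvalue. It makes \<open>det (id - D p)\<close> positive and, unlike
  nilpotency of a matrix, refers to no coordinates.\<close>

theorem unique_fixed_point_of_bounded_C1_map:
  fixes f :: "'a::euclidean_space \<Rightarrow> 'a"
  assumes f: "\<And>x. (f has_derivative D x) (at x)"
    and D: "\<And>v. continuous_on UNIV (\<lambda>x. D x v)"
    and bdd: "bounded (range f)"
    and nondeg: "\<And>p s v. \<lbrakk>f p = p; 0 \<le> s; s \<le> 1; v = s *\<^sub>R D p v\<rbrakk> \<Longrightarrow> v = 0"
  shows "\<exists>!p. f p = p"
proof (rule ex_ex1I)
  obtain r where r: "0 < r" "\<And>x. norm (f x) \<le> r"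
    using bdd by (auto simp: bounded_pos)
  have "continuous_on (cball 0 r) f"
    by (rule has_derivative_continuous_on[OF has_derivative_at_withinI[OF f]])
  then obtain p where "f p = p"
    using r by (elim brouwer_ball[OF r(1)]) auto
  then show "\<exists>p. f p = p" ..
next
  fix a b assume ab: "f a = a" "f b = b"
  have "DIM('a) = DIM(real^'a coordinate)"
    by (simp add: CARD_coordinate)
  then obtain P :: "'a \<Rightarrow> real^'a coordinate" and Q where PQ: "linear P" "linear Q"
      "\<And>x. Q (P x) = x" "\<And>y. P (Q y) = y"
    using isomorphisms_UNIV_UNIV by metis
  have bl: "bounded_linear P" "bounded_linear Q"
    using PQ by (simp_all add: linear_linear)
  have "P a = P b"
  proof (rule fixed_point_unique_wellorder[of "\<lambda>y. P (f (Q y))" "\<lambda>y v. P (D (Q y) (Q v))"])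
    show "((\<lambda>y. P (f (Q y))) has_derivative (\<lambda>v. P (D (Q y) (Q v)))) (at y)" for y
      by (intro bounded_linear.has_derivative[OF bl(1)]
          has_derivative_compose[OF bounded_linear_imp_has_derivative[OF bl(2)] f])
    show "continuous_on UNIV (\<lambda>y. P (D (Q y) (Q v)))" for v
      by (intro linear_continuous_on_compose[OF _ PQ(1)] continuous_on_compose2[OF D linear_continuous_on[OF bl(2)]]) auto
    have "bounded (P ` range f)"
      using bdd bl(1) by (rule bounded_linear_image)
    then show "bounded (range (\<lambda>y. P (f (Q y))))"
      by (rule bounded_subset) auto
    show "P (f (Q (P a))) = P a" "P (f (Q (P b))) = P b"
      using ab PQ by simp_all
  next
    fix y s v assume *: "P (f (Q y)) = y" "0 \<le> s" "s \<le> (1::real)" "v = s *\<^sub>R P (D (Q y) (Q v))"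
    have "f (Q y) = Q y"
      using *(1) PQ(3) by metis
    moreover have "Q v = s *\<^sub>R D (Q y) (Q v)"
      using arg_cong[OF *(4), of Q] by (simp add: linear_scale[OF PQ(2)] PQ(3))
    ultimately have "Q v = 0"
      using nondeg * by blast
    then show "v = 0"
      using PQ by (metis linear_0)
  qed
  then show "a = b"
    using PQ(3) by metis
qed

section \<open>Nilpotent fixed points\<close>

text \<open>Iterating the hypothesis gives \<open>v = s ^ k *\<^sub>R (matrix_power A k *v v)\<close> for all \<open>k\<close>.\<close>

lemma nilpotent_matrix_imp_scaled_fixed_vector_zero:
  fixes A :: "real^'n^'n"
  assumes "nilpotent_matrix A" and v: "v = s *\<^sub>R (A *v v)"
  shows "v = 0"
proof -
  have "v = s ^ k *\<^sub>R (matrix_power A k *v v)" for k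
  proof (induction k)
    case (Suc k)
    have "s ^ Suc k *\<^sub>R (matrix_power A (Suc k) *v v) = s *\<^sub>R (A *v (s ^ k *\<^sub>R (matrix_power A k *v v)))"
      by (simp add: matrix_power_def matrix_vector_mul_assoc[symmetric] matrix_vector_mult_scaleR)
    then show ?case using Suc v by simp
  qed (simp add: matrix_power_def)
  moreover obtain k where "matrix_power A k = 0"
    using assms(1) by (auto simp: nilpotent_matrix_def)
  ultimately show ?thesis
    by (metis matrix_vector_mult_0 scaleR_zero_right)
qed

theorem theorem11p1:
  fixes f :: "real ^ 'n \<Rightarrow> real ^ 'n"
  assumes "C1_map f"
    and "nilpotent_fixed_points f"
    and "bounded (range f)"
  shows "\<exists>!p. f p = p"
proof (rule unique_fixed_point_of_bounded_C1_map[where D = "\<lambda>x. frechet_derivative f (at x)"])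
  have "f differentiable (at x)" for x
    using assms(1) by (simp add: C1_map_def)
  then show f: "(f has_derivative frechet_derivative f (at x)) (at x)" for x
    by (rule frechet_derivative_works[THEN iffD1])
  have J: "frechet_derivative f (at x) v = jacobian f x *v v" for x v
    unfolding jacobian_def by (rule fun_cong[OF matrix_vector_mul(2)[OF has_derivative_linear[OF f]], symmetric])
  have "continuous_on UNIV (jacobian f)"
    using assms(1) by (simp add: C1_map_def)
  then show "continuous_on UNIV (\<lambda>x. frechet_derivative f (at x) v)" for v
    unfolding J matrix_vector_mult_def by (intro continuous_intros)
  show "bounded (range f)" by fact
  show "v = 0" if "f p = p" "v = s *\<^sub>R frechet_derivative f (at p) v" for p s v
    using that assms(2) nilpotent_matrix_imp_scaled_fixed_vector_zero[of "jacobian f p" v s]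
    by (simp add: nilpotent_fixed_points_def J)
qed

end
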